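(* Let $\mu>0$ and let $\psi:\mathcal{X}_{1/2}\to\mathbb{R}$ be a concave terminal payoff. Let $\bar t^\mu\doteq\mu(2m/\kappa)^{1/2}$. Then for all $t\in[0,\bar t^\mu)$ and $x\in\mathcal{X}_{1/2}$, $$W^\mu(t,x)=\sup_{z\in\mathcal{X}_{1/2}}\left\{W^{\mu,\infty}(t,x,z)+\psi(z)\right\},$$ where $W^\mu(t,x)=\sup_{w\in\mathcal{W}[0,t]}J^\mu_{m,\psi}(t,x,w)$ and $W^{\mu,\infty}(t,x,z)=\sup_{w\in\mathcal{W}[0,t]}J^\mu_{m,\psi^{\mu,\infty}(\cdot,z)}(t,x,w)$.
   Context: Fix constants $L,\kappa,m>0$ and $\Lambda=(0,L)$. $\mathcal{X}=L^2(\Lambda;\mathbb{R})$ with the standard inner product $\langle\cdot,\cdot\rangle$ and norm $\|\cdot\|$. $\mathcal{X}_0=\{x\in\mathcal{X}: x,\partial x \text{ absolutely continuous},\ x(0)=0=x(L),\ \partial^2x\in\mathcal{X}\}$. $\mathcal{A}x=-\partial^2x$ with domain $\mathcal{X}_0$; it is a self-adjoint, positive, boundedly invertible operator on $\mathcal{X}$, with unique positive self-adjoint square root $\mathcal{A}^{1/2}$, and $\mathcal{J}\doteq(\mathcal{A}^{1/2})^{-1}$. $\mathcal{X}_{1/2}=\mathrm{dom}(\mathcal{A}^{1/2})$ is a Hilbert space with $\langle x,\xi\rangle_{1/2}=\langle\mathcal{A}^{1/2}x,\mathcal{A}^{1/2}\xi\rangle$ and norm $\|\cdot\|_{1/2}$.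 $\mathcal{W}[0,t]=L^2([0,t];\mathcal{X}_{1/2})$. For $\mu>0$ and $w\in\mathcal{X}_{1/2}$, $\mathcal{J}^\mu w=(\mathcal{J}w,\mu w)$, and $\|\mathcal{J}^\mu w\|_{1/2}^2=\|\mathcal{J}w\|_{1/2}^2+\mu^2\|w\|_{1/2}^2$. For $M>0$ and a terminal payoff $\psi:\mathcal{X}_{1/2}\to\mathbb{R}\cup\{-\infty\}$, $$J^\mu_{M,\psi}(t,x,w)=\int_0^t\Big(\tfrac{\kappa}{2}\|\xi(s)\|_{1/2}^2-\tfrac{M}{2}\|\mathcal{J}^\mu w(s)\|_{1/2}^2\Big)ds+\psi(\xi(t)),\qquad \xi(s)=x+\int_0^sw(\sigma)\,d\sigma.$$ $\mathcal{K}_\mu$ is a fixed bounded, boundedly invertible linear operator on $\mathcal{X}_{1/2}$, and $\psi^{\mu,\infty}(x,z)=0$ if $\|\mathcal{K}_\mu(x-z)\|_{1/2}=0$, $\psi^{\mu,\infty}(x,z)=-\infty$ if $\|\mathcal{K}_\mu(x-z)\|_{1/2}>0$. Standing assumption: with a fixed $\underline{m}\in(0,m)$ and $\overline{W}^\mu(t,x)\doteq\sup_{w\in\mathcal{W}[0,t]}J^\mu_{\underline{m},0}(t,x,w)$ (zero terminal payoff), $\overline{W}^\mu(t,x)<\infty$ for all $\mu\in(0,1]$, $t\in(0,\bar t^\mu)$, $x\in\mathcal{X}_{1/2}$. *)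

theory Defs
  imports "HOL-Analysis.Analysis"
begin

text \<open>
  The separable Hilbert space of (classes of) square integrable real functions on the whole line.
  It serves as an ambient type: the space of square integrable functions on \<open>(0, L)\<close> is the closed
  subspace \<open>L2_interval L\<close> below, with \<open>L\<close> an ordinary real parameter. Borel representatives
  suffice, since every Lebesgue measurable function agrees almost everywhere with a Borel one.
\<close>

definition sq_integrable :: "(real \<Rightarrow> real) \<Rightarrow> bool" where
  "sq_integrable f \<longleftrightarrow> f \<in> borel_measurable lborel \<and> integrable lborel (\<lambda>s. (f s)\<^sup>2)"

lemma sq_integrable_mult:
  assumes "sq_integrable f" "sq_integrable g"
  shows "integrable lborel (\<lambda>s. f s * g s)"
proof (rule Bochner_Integration.integrable_bound)
  show "integrable lborel (\<lambda>s. (f s)\<^sup>2 + (g s)\<^sup>2)"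
    using assms by (auto simp: sq_integrable_def)
  show "(\<lambda>s. f s * g s) \<in> borel_measurable lborel"
    using assms by (auto simp: sq_integrable_def)
  show "AE s in lborel. norm (f s * g s) \<le> norm ((f s)\<^sup>2 + (g s)\<^sup>2)"
  proof (rule AE_I2)
    fix s
    have "0 \<le> (\<bar>f s\<bar> - \<bar>g s\<bar>)\<^sup>2" by simp
    then have "2 * (\<bar>f s\<bar> * \<bar>g s\<bar>) \<le> (f s)\<^sup>2 + (g s)\<^sup>2"
      by (simp add: power2_diff)
    moreover have "0 \<le> \<bar>f s\<bar> * \<bar>g s\<bar>" by (rule mult_nonneg_nonneg) simp_all
    ultimately show "norm (f s * g s) \<le> norm ((f s)\<^sup>2 + (g s)\<^sup>2)"
      unfolding real_norm_def abs_mult by linarith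
  qed
qed

lemma sq_integrable_0 [simp]: "sq_integrable (\<lambda>s. 0)"
  by (simp add: sq_integrable_def)

lemma sq_integrable_cmult: "sq_integrable f \<Longrightarrow> sq_integrable (\<lambda>s. r * f s)"
  by (auto simp: sq_integrable_def power_mult_distrib)

lemma sq_integrable_add:
  assumes "sq_integrable f" "sq_integrable g"
  shows "sq_integrable (\<lambda>s. f s + g s)"
proof -
  have "integrable lborel (\<lambda>s. (f s)\<^sup>2 + (g s)\<^sup>2 + 2 * (f s * g s))"
    using assms sq_integrable_mult[OF assms] by (auto simp: sq_integrable_def)
  then have "integrable lborel (\<lambda>s. (f s + g s)\<^sup>2)"
    by (simp add: power2_sum mult.assoc)
  then show ?thesis
    using assms by (auto simp: sq_integrable_def)
qed

lemma sq_integrable_diff: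
  assumes "sq_integrable f" "sq_integrable g"
  shows "sq_integrable (\<lambda>s. f s - g s)"
  using sq_integrable_add[OF assms(1) sq_integrable_cmult[OF assms(2), of "-1"]] by simp

quotient_type L2 = "real \<Rightarrow> real" / partial:
  "\<lambda>f g. sq_integrable f \<and> sq_integrable g \<and> (AE s in lborel. f s = g s)"
proof (rule part_equivpI)
  show "\<exists>f. sq_integrable f \<and> sq_integrable f \<and> (AE s in lborel. f s = f s)"
    by (rule exI[of _ "\<lambda>s. 0"]) simp
  show "symp (\<lambda>f g. sq_integrable f \<and> sq_integrable g \<and> (AE s in lborel. f s = g s))"
    by (auto intro!: sympI)
  show "transp (\<lambda>f g. sq_integrable f \<and> sq_integrable g \<and> (AE s in lborel. f s = g s))"
    by (rule transpI) (auto elim: AE_mp)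
qed

lemma L2_rep: "sq_integrable (rep_L2 x)"
  using Quotient_rep_reflp[OF Quotient_L2, of x] by simp

lemma L2_rep_measurable [measurable]: "rep_L2 x \<in> borel_measurable lborel"
  using L2_rep[of x] by (simp add: sq_integrable_def)

lemma L2_abs_rep [simp]: "abs_L2 (rep_L2 x) = x"
  using Quotient_abs_rep[OF Quotient_L2] .

lemma L2_abs_eq_iff:
  "sq_integrable f \<Longrightarrow> sq_integrable g \<Longrightarrow> abs_L2 f = abs_L2 g \<longleftrightarrow> (AE s in lborel. f s = g s)"
  using Quotient_rel[OF Quotient_L2, of f g] by simp

lemma L2_rep_abs: "sq_integrable f \<Longrightarrow> AE s in lborel. rep_L2 (abs_L2 f) s = f s"
  using L2_abs_eq_iff[OF L2_rep, of f "abs_L2 f"] by simp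

lemma L2_eq_iff: "x = y \<longleftrightarrow> (AE s in lborel. rep_L2 x s = rep_L2 y s)"
  using L2_abs_eq_iff[OF L2_rep L2_rep, of x y] by simp

instantiation L2 :: real_inner
begin

definition zero_L2 :: L2 where "0 = abs_L2 (\<lambda>s. 0)"
definition plus_L2 :: "L2 \<Rightarrow> L2 \<Rightarrow> L2" where
  "x + y = abs_L2 (\<lambda>s. rep_L2 x s + rep_L2 y s)"
definition uminus_L2 :: "L2 \<Rightarrow> L2" where "- x = abs_L2 (\<lambda>s. -1 * rep_L2 x s)"
definition minus_L2 :: "L2 \<Rightarrow> L2 \<Rightarrow> L2" where
  "x - y = abs_L2 (\<lambda>s. rep_L2 x s - rep_L2 y s)"
definition scaleR_L2 :: "real \<Rightarrow> L2 \<Rightarrow> L2" where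
  "r *\<^sub>R x = abs_L2 (\<lambda>s. r * rep_L2 x s)"
definition inner_L2 :: "L2 \<Rightarrow> L2 \<Rightarrow> real" where
  "x \<bullet> y = (LINT s|lborel. rep_L2 x s * rep_L2 y s)"
definition norm_L2 :: "L2 \<Rightarrow> real" where "norm_L2 x = sqrt (x \<bullet> x)"
definition sgn_L2 :: "L2 \<Rightarrow> L2" where "sgn_L2 x = inverse (norm x) *\<^sub>R x"
definition dist_L2 :: "L2 \<Rightarrow> L2 \<Rightarrow> real" where "dist_L2 x y = norm (x - y)"
definition uniformity_L2 :: "(L2 \<times> L2) filter" where
  "uniformity_L2 = (INF e\<in>{0<..}. principal {(x, y). dist x y < e})"
definition open_L2 :: "L2 set \<Rightarrow> bool" where
  "open_L2 U \<longleftrightarrow> (\<forall>x\<in>U. eventually (\<lambda>(x', y). x' = x \<longrightarrow> y \<in> U) uniformity)"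

lemma rep_zero: "AE s in lborel. rep_L2 0 s = 0"
  unfolding zero_L2_def by (rule L2_rep_abs) simp
lemma rep_plus: "AE s in lborel. rep_L2 (x + y) s = rep_L2 x s + rep_L2 y s"
  unfolding plus_L2_def by (intro L2_rep_abs sq_integrable_add L2_rep)
lemma rep_uminus: "AE s in lborel. rep_L2 (- x) s = -1 * rep_L2 x s"
  unfolding uminus_L2_def by (intro L2_rep_abs sq_integrable_cmult L2_rep)
lemma rep_minus: "AE s in lborel. rep_L2 (x - y) s = rep_L2 x s - rep_L2 y s"
  unfolding minus_L2_def by (intro L2_rep_abs sq_integrable_diff L2_rep)
lemma rep_scaleR: "AE s in lborel. rep_L2 (r *\<^sub>R x) s = r * rep_L2 x s"
  unfolding scaleR_L2_def by (intro L2_rep_abs sq_integrable_cmult L2_rep)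

instance
proof
  fix x y z :: L2 and r q :: real
  show "x + y + z = x + (y + z)"
    unfolding L2_eq_iff
    using rep_plus[of "x + y" z] rep_plus[of x y] rep_plus[of x "y + z"] rep_plus[of y z]
    by eventually_elim simp
  show "x + y = y + x"
    unfolding L2_eq_iff using rep_plus[of x y] rep_plus[of y x] by eventually_elim simp
  show "0 + x = x"
    unfolding L2_eq_iff using rep_plus[of 0 x] rep_zero by eventually_elim simp
  show "- x + x = 0"
    unfolding L2_eq_iff using rep_plus[of "- x" x] rep_uminus[of x] rep_zero
    by eventually_elim simp
  show "x - y = x + - y"
    unfolding L2_eq_iff using rep_plus[of x "- y"] rep_uminus[of y] rep_minus[of x y]
    by eventually_elim simp
  show "r *\<^sub>R (x + y) = r *\<^sub>R x + r *\<^sub>R y"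
    unfolding L2_eq_iff
    using rep_scaleR[of r "x + y"] rep_plus[of x y] rep_plus[of "r *\<^sub>R x" "r *\<^sub>R y"]
      rep_scaleR[of r x] rep_scaleR[of r y]
    by eventually_elim (simp add: algebra_simps)
  show "(r + q) *\<^sub>R x = r *\<^sub>R x + q *\<^sub>R x"
    unfolding L2_eq_iff
    using rep_scaleR[of "r + q" x] rep_plus[of "r *\<^sub>R x" "q *\<^sub>R x"]
      rep_scaleR[of r x] rep_scaleR[of q x]
    by eventually_elim (simp add: algebra_simps)
  show "r *\<^sub>R q *\<^sub>R x = (r * q) *\<^sub>R x"
    unfolding L2_eq_iff
    using rep_scaleR[of "r * q" x] rep_scaleR[of r "q *\<^sub>R x"] rep_scaleR[of q x]
    by eventually_elim (simp add: algebra_simps)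
  show "1 *\<^sub>R x = x"
    unfolding L2_eq_iff using rep_scaleR[of 1 x] by eventually_elim simp
  show "x \<bullet> y = y \<bullet> x"
    by (simp add: inner_L2_def mult.commute)
  have "(x + y) \<bullet> z = (LINT s|lborel. rep_L2 x s * rep_L2 z s + rep_L2 y s * rep_L2 z s)"
    unfolding inner_L2_def
    by (intro integral_cong_AE) (use rep_plus[of x y] in \<open>auto simp: algebra_simps\<close>)
  then show "(x + y) \<bullet> z = x \<bullet> z + y \<bullet> z"
    by (simp add: inner_L2_def sq_integrable_mult L2_rep)
  have "(r *\<^sub>R x) \<bullet> y = (LINT s|lborel. r * (rep_L2 x s * rep_L2 y s))"
    unfolding inner_L2_def
    by (intro integral_cong_AE) (use rep_scaleR[of r x] in \<open>auto simp: algebra_simps\<close>)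
  then show "(r *\<^sub>R x) \<bullet> y = r * (x \<bullet> y)"
    by (simp add: inner_L2_def)
  show "0 \<le> x \<bullet> x"
    by (simp add: inner_L2_def)
  have "x \<bullet> x = 0 \<longleftrightarrow> (AE s in lborel. rep_L2 x s * rep_L2 x s = 0)"
    unfolding inner_L2_def
    by (intro integral_nonneg_eq_0_iff_AE sq_integrable_mult L2_rep) simp
  also have "\<dots> \<longleftrightarrow> (AE s in lborel. rep_L2 x s = rep_L2 0 s)"
    using rep_zero by (auto elim!: AE_mp)
  finally show "x \<bullet> x = 0 \<longleftrightarrow> x = 0"
    by (simp only: L2_eq_iff)
qed (simp_all add: norm_L2_def sgn_L2_def dist_L2_def uniformity_L2_def open_L2_def)

end

lemma L2_norm_power2: "(norm (x :: L2))\<^sup>2 = (LINT s|lborel. (rep_L2 x s)\<^sup>2)"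
  unfolding power2_norm_eq_inner inner_L2_def by (simp add: power2_eq_square)

lemma abs_L2_add:
  assumes "sq_integrable f" "sq_integrable g"
  shows "abs_L2 f + abs_L2 g = abs_L2 (\<lambda>s. f s + g s)"
  unfolding plus_L2_def
  using L2_rep_abs[OF assms(1)] L2_rep_abs[OF assms(2)]
  by (intro L2_abs_eq_iff[THEN iffD2] sq_integrable_add L2_rep assms) auto

lemma abs_L2_diff:
  assumes "sq_integrable f" "sq_integrable g"
  shows "abs_L2 f - abs_L2 g = abs_L2 (\<lambda>s. f s - g s)"
  unfolding minus_L2_def
  using L2_rep_abs[OF assms(1)] L2_rep_abs[OF assms(2)]
  by (intro L2_abs_eq_iff[THEN iffD2] sq_integrable_diff L2_rep assms) auto

lemma abs_L2_scaleR:
  assumes "sq_integrable f"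
  shows "r *\<^sub>R abs_L2 f = abs_L2 (\<lambda>s. r * f s)"
  unfolding scaleR_L2_def
  using L2_rep_abs[OF assms]
  by (intro L2_abs_eq_iff[THEN iffD2] sq_integrable_cmult L2_rep assms) auto

lemma abs_L2_sum:
  assumes "finite I" "\<And>i. i \<in> I \<Longrightarrow> sq_integrable (f i)"
  shows "sq_integrable (\<lambda>s. \<Sum>i\<in>I. f i s) \<and> (\<Sum>i\<in>I. abs_L2 (f i)) = abs_L2 (\<lambda>s. \<Sum>i\<in>I. f i s)"
  using assms
  by (induction I rule: finite_induct) (auto simp: sq_integrable_add abs_L2_add zero_L2_def)

lemma norm_abs_L2: "sq_integrable f \<Longrightarrow> (norm (abs_L2 f))\<^sup>2 = (LINT s|lborel. (f s)\<^sup>2)"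
  unfolding L2_norm_power2
  using L2_rep_abs[of f] by (intro integral_cong_AE) (auto simp: sq_integrable_def)

lemma abs_L2_dominated_convergence:
  assumes f: "sq_integrable f" and g: "\<And>n. sq_integrable (g n)" and h: "sq_integrable h"
    and lim: "\<And>s. (\<lambda>n. g n s) \<longlonglongrightarrow> f s" and le: "\<And>n s. \<bar>g n s\<bar> \<le> h s"
  shows "(\<lambda>n. abs_L2 (g n)) \<longlonglongrightarrow> abs_L2 f"
proof -
  have [measurable]: "f \<in> borel_measurable lborel" "g n \<in> borel_measurable lborel" for n
    using f g by (auto simp: sq_integrable_def)
  have fle: "\<bar>f s\<bar> \<le> h s" for s
    by (rule LIMSEQ_le_const2[OF tendsto_rabs[OF lim]]) (use le in auto)
  have "(\<lambda>n. LINT s|lborel. (g n s - f s)\<^sup>2) \<longlonglongrightarrow> (LINT s|(lborel :: real measure). 0)"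
  proof (rule integral_dominated_convergence[where w = "\<lambda>s. 4 * (h s)\<^sup>2"])
    show "integrable lborel (\<lambda>s. 4 * (h s)\<^sup>2)"
      using h by (simp add: sq_integrable_def)
    show "AE s in lborel. (\<lambda>n. (g n s - f s)\<^sup>2) \<longlonglongrightarrow> 0"
    proof (rule AE_I2)
      fix s
      have "(\<lambda>n. (g n s - f s)\<^sup>2) \<longlonglongrightarrow> (f s - f s)\<^sup>2"
        by (intro tendsto_intros lim)
      then show "(\<lambda>n. (g n s - f s)\<^sup>2) \<longlonglongrightarrow> 0" by simp
    qed
    show "AE s in lborel. norm ((g n s - f s)\<^sup>2) \<le> 4 * (h s)\<^sup>2" for n
    proof (rule AE_I2)
      fix s
      have "\<bar>g n s - f s\<bar> \<le> 2 * h s"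
        using le[of n s] fle[of s] by linarith
      then have "\<bar>g n s - f s\<bar>\<^sup>2 \<le> (2 * h s)\<^sup>2"
        by (intro power_mono) auto
      then show "norm ((g n s - f s)\<^sup>2) \<le> 4 * (h s)\<^sup>2"
        by (simp add: power_mult_distrib)
    qed
  qed simp_all
  then have "(\<lambda>n. (norm (abs_L2 (g n) - abs_L2 f))\<^sup>2) \<longlonglongrightarrow> 0"
    using f g by (simp add: abs_L2_diff norm_abs_L2 sq_integrable_diff)
  then have "(\<lambda>n. sqrt ((norm (abs_L2 (g n) - abs_L2 f))\<^sup>2)) \<longlonglongrightarrow> sqrt 0"
    by (rule tendsto_real_sqrt)
  then show ?thesis
    by (simp add: LIM_zero_iff tendsto_norm_zero_iff)
qed

instance L2 :: complete_space
proof
  fix X :: "nat \<Rightarrow> L2"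
  assume "Cauchy X"
  then have "\<forall>k. \<exists>N. \<forall>m\<ge>N. \<forall>n\<ge>N. norm (X m - X n) < (1/2) ^ k"
    by (auto simp: Cauchy_def dist_norm)
  then obtain N where N: "\<And>k m n. m \<ge> N k \<Longrightarrow> n \<ge> N k \<Longrightarrow> norm (X m - X n) < (1/2) ^ k"
    by metis
  define r where "r k = (\<Sum>i\<le>k. N i)" for k
  have r: "N k \<le> r j" if "k \<le> j" for k j
    unfolding r_def using that by (intro member_le_sum) auto
  define g where "g k = rep_L2 (X (r k))" for k
  have g_meas [measurable]: "g k \<in> borel_measurable lborel" for k
    by (simp add: g_def)
  have nn_norm: "(\<integral>\<^sup>+ s. ennreal ((rep_L2 x s - rep_L2 y s)\<^sup>2) \<partial>lborel) = ennreal ((norm (x - y))\<^sup>2)"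
    for x y :: L2
  proof -
    have "(\<integral>\<^sup>+ s. ennreal ((rep_L2 x s - rep_L2 y s)\<^sup>2) \<partial>lborel)
        = ennreal (LINT s|lborel. (rep_L2 x s - rep_L2 y s)\<^sup>2)"
      using sq_integrable_diff[OF L2_rep L2_rep, of x y]
      by (intro nn_integral_eq_integral) (auto simp: sq_integrable_def)
    also have "(LINT s|lborel. (rep_L2 x s - rep_L2 y s)\<^sup>2) = (norm (x - y))\<^sup>2"
      using norm_abs_L2[OF sq_integrable_diff[OF L2_rep L2_rep, of x y]]
      by (simp add: minus_L2_def)
    finally show ?thesis .
  qed
  define d where "d = (\<lambda>k s. g (Suc k) s - g k s)"
  have [measurable]: "d k \<in> borel_measurable lborel" for k
    by (simp add: d_def)
  have d_le: "(\<integral>\<^sup>+ s. ennreal (2 ^ k * (d k s)\<^sup>2) \<partial>lborel) \<le> ennreal ((1/2) ^ k)" for k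
  proof -
    have "(\<integral>\<^sup>+ s. ennreal (2 ^ k * (d k s)\<^sup>2) \<partial>lborel)
        = (\<integral>\<^sup>+ s. ennreal (2 ^ k) * ennreal ((d k s)\<^sup>2) \<partial>lborel)"
      by (simp add: ennreal_mult)
    also have "\<dots> = ennreal (2 ^ k) * (\<integral>\<^sup>+ s. ennreal ((d k s)\<^sup>2) \<partial>lborel)"
      by (rule nn_integral_cmult) simp
    also have "\<dots> = ennreal (2 ^ k * (norm (X (r (Suc k)) - X (r k)))\<^sup>2)"
      by (simp add: d_def g_def nn_norm ennreal_mult)
    also have "\<dots> \<le> ennreal (2 ^ k * ((1/2) ^ k)\<^sup>2)"
      using N[of k "r (Suc k)" "r k"] r
      by (intro ennreal_leI mult_left_mono power_mono) (auto intro: less_imp_le)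
    also have "(2::real) ^ k * ((1/2) ^ k)\<^sup>2 = (1/2) ^ k"
      by (simp add: power2_eq_square power_divide)
    finally show ?thesis .
  qed
  have "(\<integral>\<^sup>+ s. (\<Sum>k. ennreal (2 ^ k * (d k s)\<^sup>2)) \<partial>lborel)
      = (\<Sum>k. \<integral>\<^sup>+ s. ennreal (2 ^ k * (d k s)\<^sup>2) \<partial>lborel)"
    by (rule nn_integral_suminf) simp
  also have "\<dots> \<le> (\<Sum>k. ennreal ((1/2) ^ k))"
    by (intro suminf_le d_le) auto
  also have "\<dots> = ennreal (\<Sum>k. (1/2) ^ k)"
    by (intro suminf_ennreal2) (auto intro: summable_geometric)
  also have "\<dots> < \<infinity>" by simp
  finally have "AE s in lborel. (\<Sum>k. ennreal (2 ^ k * (d k s)\<^sup>2)) \<noteq> \<infinity>"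
    by (intro nn_integral_PInf_AE) auto
  then have conv: "AE s in lborel. convergent (\<lambda>k. g k s)"
  proof (rule AE_mp, intro AE_I2 impI)
    fix s :: real
    assume fin: "(\<Sum>k. ennreal (2 ^ k * (d k s)\<^sup>2)) \<noteq> \<infinity>"
    then obtain C where C: "(\<Sum>k. ennreal (2 ^ k * (d k s)\<^sup>2)) = ennreal C" "C \<ge> 0"
      by (metis ennreal_cases infinity_ennreal_def)
    have "\<bar>d k s\<bar> \<le> sqrt C * (1 / sqrt 2) ^ k" for k
    proof -
      have "(\<Sum>i\<in>{k}. ennreal (2 ^ i * (d i s)\<^sup>2)) \<le> (\<Sum>i. ennreal (2 ^ i * (d i s)\<^sup>2))"
        by (rule sum_le_suminf) auto
      then have "2 ^ k * (d k s)\<^sup>2 \<le> C"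
        using C by simp
      then have "sqrt (2 ^ k * (d k s)\<^sup>2) \<le> sqrt C" by simp
      then have "sqrt 2 ^ k * \<bar>d k s\<bar> \<le> sqrt C"
        by (simp add: real_sqrt_mult real_sqrt_power[of 2 k])
      then show ?thesis
        by (simp add: power_divide field_simps)
    qed
    moreover have "summable (\<lambda>k. sqrt C * (1 / sqrt 2) ^ k)"
      by (intro summable_mult summable_geometric) simp
    ultimately have "summable (\<lambda>k. d k s)"
      by (intro summable_comparison_test[of "\<lambda>k. d k s" "\<lambda>k. sqrt C * (1 / sqrt 2) ^ k"]) auto
    then have "convergent (\<lambda>n. g 0 s + (\<Sum>k<n. d k s))"
      by (intro convergent_add convergent_const) (simp add: summable_iff_convergent)
    moreover have "(\<lambda>n. g 0 s + (\<Sum>k<n. d k s)) = (\<lambda>n. g n s)"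
      unfolding d_def by (simp add: sum_lessThan_telescope[of "\<lambda>n. g n s" for s])
    ultimately show "convergent (\<lambda>k. g k s)" by simp
  qed
  define f where "f = (\<lambda>s. lim (\<lambda>k. g k s))"
  have [measurable]: "f \<in> borel_measurable lborel"
    unfolding f_def by (rule borel_measurable_lim_metric) simp
  have bound: "(\<integral>\<^sup>+ s. ennreal ((rep_L2 (X n) s - f s)\<^sup>2) \<partial>lborel) \<le> ennreal (((1/2) ^ k)\<^sup>2)"
    if "n \<ge> N k" for n k
  proof -
    have "(\<integral>\<^sup>+ s. ennreal ((rep_L2 (X n) s - f s)\<^sup>2) \<partial>lborel)
        = (\<integral>\<^sup>+ s. liminf (\<lambda>j. ennreal ((rep_L2 (X n) s - g j s)\<^sup>2)) \<partial>lborel)"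
    proof (rule nn_integral_cong_AE, use conv in eventually_elim)
      fix s :: real
      assume "convergent (\<lambda>k. g k s)"
      then have "(\<lambda>j. g j s) \<longlonglongrightarrow> f s"
        by (simp add: f_def convergent_LIMSEQ_iff)
      then have "(\<lambda>j. ennreal ((rep_L2 (X n) s - g j s)\<^sup>2)) \<longlonglongrightarrow> ennreal ((rep_L2 (X n) s - f s)\<^sup>2)"
        by (intro tendsto_intros)
      then show "ennreal ((rep_L2 (X n) s - f s)\<^sup>2) = liminf (\<lambda>j. ennreal ((rep_L2 (X n) s - g j s)\<^sup>2))"
        by (intro lim_imp_Liminf[symmetric]) auto
    qed
    also have "\<dots> \<le> liminf (\<lambda>j. \<integral>\<^sup>+ s. ennreal ((rep_L2 (X n) s - g j s)\<^sup>2) \<partial>lborel)"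
      by (rule nn_integral_liminf) simp
    also have "\<dots> \<le> liminf (\<lambda>j. ennreal (((1/2) ^ k)\<^sup>2))"
    proof (rule Liminf_mono, rule eventually_sequentiallyI[of k])
      fix j assume "k \<le> j"
      then have "norm (X n - X (r j)) \<le> (1/2) ^ k"
        using N[OF that r] by (simp add: less_imp_le)
      then show "(\<integral>\<^sup>+ s. ennreal ((rep_L2 (X n) s - g j s)\<^sup>2) \<partial>lborel) \<le> ennreal (((1/2) ^ k)\<^sup>2)"
        unfolding g_def nn_norm by (intro ennreal_leI power_mono) auto
    qed
    also have "\<dots> = ennreal (((1/2) ^ k)\<^sup>2)"
      by (simp add: Liminf_const)
    finally show ?thesis .
  qed
  have sq: "sq_integrable (\<lambda>s. rep_L2 (X n) s - f s)" if "n \<ge> N k" for n k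
    unfolding sq_integrable_def integrable_iff_bounded
    using le_less_trans[OF bound[OF that]] by simp
  have f: "sq_integrable f"
    using sq_integrable_diff[OF L2_rep sq[OF order.refl, of 0], of "X (N 0)"] by simp
  have "norm (X n - abs_L2 f) \<le> (1/2) ^ k" if "n \<ge> N k" for n k
  proof -
    have "X n - abs_L2 f = abs_L2 (\<lambda>s. rep_L2 (X n) s - f s)"
      using abs_L2_diff[OF L2_rep f, of "X n"] by simp
    then have "ennreal ((norm (X n - abs_L2 f))\<^sup>2) = (\<integral>\<^sup>+ s. ennreal ((rep_L2 (X n) s - f s)\<^sup>2) \<partial>lborel)"
      using norm_abs_L2[OF sq[OF that]] sq[OF that]
      by (simp add: nn_integral_eq_integral sq_integrable_def)
    then have "ennreal ((norm (X n - abs_L2 f))\<^sup>2) \<le> ennreal (((1/2) ^ k)\<^sup>2)"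
      using bound[OF that] by (simp only:)
    then have "(norm (X n - abs_L2 f))\<^sup>2 \<le> ((1/2) ^ k)\<^sup>2"
      by (simp only: ennreal_le_iff zero_le_power2)
    then show ?thesis
      by (rule power2_le_imp_le) simp
  qed
  moreover have "\<exists>k. (1/2) ^ k < e" if "e > 0" for e :: real
    using that by (intro real_arch_pow_inv) auto
  ultimately have "X \<longlonglongrightarrow> abs_L2 f"
    unfolding lim_sequentially dist_norm by (meson le_less_trans)
  then show "convergent X"
    by (auto simp: convergent_def)
qed

lemma separable_imp_second_countable:
  fixes D :: "'a :: metric_space set"
  assumes "countable D" "closure D = UNIV"
  shows "\<exists>B :: 'a set set. countable B \<and> open = generate_topology B"
proof (intro exI conjI)
  let ?B = "(\<lambda>(x, n). ball x (1 / real (Suc n))) ` (D \<times> (UNIV :: nat set))"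
  show "countable ?B"
    using assms(1) by (intro countable_image countable_SIGMA) auto
  have "topological_basis ?B"
  proof (rule topological_basisI)
    fix U and x :: 'a
    assume "open U" "x \<in> U"
    then obtain e where e: "e > 0" "ball x e \<subseteq> U"
      by (auto simp: open_contains_ball)
    obtain n where n: "1 / real (Suc n) < e / 2"
      using nat_approx_posE[of "e / 2"] e by auto
    obtain y where y: "y \<in> D" "dist y x < 1 / real (Suc n)"
      using assms(2) closure_approachable[of x D] by (metis UNIV_I of_nat_0_less_iff zero_less_Suc zero_less_divide_1_iff)
    have "ball y (1 / real (Suc n)) \<subseteq> ball x e"
    proof
      fix z assume "z \<in> ball y (1 / real (Suc n))"
      then have "dist y z < 1 / real (Suc n)" by simp
      then show "z \<in> ball x e"
        using y(2) n dist_triangle[of x z y] by (simp add: dist_commute)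
    qed
    then show "\<exists>B'\<in>?B. x \<in> B' \<and> B' \<subseteq> U"
      using y e by (intro bexI[of _ "ball y (1 / real (Suc n))"]) auto
  qed auto
  then show "open = generate_topology ?B"
    by (rule topological_basis_imp_subbasis)
qed

instance L2 :: second_countable_topology
proof
  let ?I = "\<lambda>a b. indicat_real {a<..b}"
  let ?G = "\<lambda>(q, a, b). of_rat q *\<^sub>R abs_L2 (?I (of_rat a) (of_rat b))"
  define S where "S qs = sum_list (map ?G qs)" for qs :: "(rat \<times> rat \<times> rat) list"
  define D where "D = range S"
  define C where "C = closure D"
  have countable_D: "countable D"
    unfolding D_def by simp
  have D_add: "x + y \<in> D" if "x \<in> D" "y \<in> D" for x y
  proof -
    obtain ps qs where "x = S ps" "y = S qs"
      using \<open>x \<in> D\<close> \<open>y \<in> D\<close> unfolding D_def by blast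
    then have "x + y = S (ps @ qs)" by (simp add: S_def)
    then show ?thesis by (simp add: D_def)
  qed
  have D_scaleR: "of_rat q *\<^sub>R x \<in> D" if "x \<in> D" for q x
  proof -
    obtain ps where ps: "x = S ps"
      using \<open>x \<in> D\<close> unfolding D_def by blast
    have "of_rat q *\<^sub>R S ps = S (map (\<lambda>(p, ab). (q * p, ab)) ps)"
      by (induction ps) (auto simp: S_def algebra_simps of_rat_mult)
    then show ?thesis by (simp add: D_def ps)
  qed
  have C_add: "x + y \<in> C" if xy: "x \<in> C" "y \<in> C" for x y
  proof -
    obtain u v where "\<And>n. u n \<in> D" "u \<longlonglongrightarrow> x" "\<And>n. v n \<in> D" "v \<longlonglongrightarrow> y"
      using xy unfolding C_def closure_sequential by metis
    then show ?thesis
      unfolding C_def closure_sequential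
      by (intro exI[of _ "\<lambda>n. u n + v n"]) (auto intro: D_add tendsto_add)
  qed
  have C_scaleR: "c *\<^sub>R x \<in> C" if "x \<in> C" for c x
  proof -
    obtain u where u: "\<And>n. u n \<in> D" "u \<longlonglongrightarrow> x"
      using \<open>x \<in> C\<close> unfolding C_def closure_sequential by metis
    have "\<exists>q. c - 1 / real (Suc n) < of_rat q \<and> of_rat q < c" for n
      using of_rat_dense[of "c - 1 / real (Suc n)" c] by auto
    then obtain q where q: "\<And>n. c - 1 / real (Suc n) < of_rat (q n)" "\<And>n. of_rat (q n) < c"
      by metis
    have "(\<lambda>n. of_rat (q n)) \<longlonglongrightarrow> c"
    proof (rule tendsto_sandwich)
      show "\<forall>\<^sub>F n in sequentially. c - 1 / real (Suc n) \<le> of_rat (q n)"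
        by (intro always_eventually allI less_imp_le q)
      show "\<forall>\<^sub>F n in sequentially. of_rat (q n) \<le> c"
        by (intro always_eventually allI less_imp_le q)
      show "(\<lambda>n. c - 1 / real (Suc n)) \<longlonglongrightarrow> c"
        using tendsto_diff[OF tendsto_const LIMSEQ_inverse_real_of_nat, of c]
        by (simp add: inverse_eq_divide)
    qed auto
    then have "(\<lambda>n. of_rat (q n) *\<^sub>R u n) \<longlonglongrightarrow> c *\<^sub>R x"
      using u(2) by (rule tendsto_scaleR)
    then show ?thesis
      unfolding C_def closure_sequential
      by (intro exI[of _ "\<lambda>n. of_rat (q n) *\<^sub>R u n"]) (simp add: D_scaleR u(1))
  qed
  have C_lim: "x \<in> C" if "\<And>n. u n \<in> C" "u \<longlonglongrightarrow> x" for u x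
    using that unfolding C_def by (intro closed_sequentially[of "closure D" u x]) auto
  have C_diff: "x - y \<in> C" if "x \<in> C" "y \<in> C" for x y
    using C_add[OF that(1) C_scaleR[OF that(2), of "-1"]] by simp
  have C_0: "0 \<in> C"
    using closure_subset[of D] rangeI[of S "[]"] by (auto simp: C_def D_def S_def)
  have C_sum: "(\<Sum>i\<in>J. x i) \<in> C" if "\<And>i. i \<in> J \<Longrightarrow> x i \<in> C" for J :: "'b set" and x
    using that by (induction J rule: infinite_finite_induct) (auto intro: C_0 C_add)
  have sq_ind: "sq_integrable (indicat_real A)"
    if "A \<in> sets lborel" "A \<subseteq> {a<..b}" for A a b
  proof -
    have "emeasure lborel A \<le> emeasure lborel {a<..b}"
      using that by (intro emeasure_mono) auto
    also have "\<dots> < \<infinity>"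
      by (cases "a \<le> b") auto
    finally have "integrable lborel (indicat_real A)"
      using that by (intro integrable_real_indicator) auto
    moreover have "(\<lambda>s. (indicat_real A s)\<^sup>2) = indicat_real A"
      by (auto simp: indicator_def)
    ultimately show ?thesis
      using that by (simp add: sq_integrable_def)
  qed
  have C_rat: "abs_L2 (?I (of_rat a) (of_rat b)) \<in> C" for a b
  proof -
    have "S [(1, a, b)] \<in> D"
      unfolding D_def by (rule rangeI)
    then show ?thesis
      using closure_subset[of D] by (auto simp: C_def S_def)
  qed
  have C_Ioc: "abs_L2 (?I a b) \<in> C" for a b
  proof -
    have "\<exists>q. c < of_rat q \<and> of_rat q < c + 1 / real (Suc n)" for c n
      using of_rat_dense[of c "c + 1 / real (Suc n)"] by auto
    then obtain q where q: "\<And>c n. c < real_of_rat (q c n)"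
        "\<And>c n. real_of_rat (q c n) < c + 1 / real (Suc n)"
      by metis
    have ev: "\<forall>\<^sub>F n in sequentially. real_of_rat (q c n) < s" if "c < s" for c s
    proof -
      obtain m where "1 / real (Suc m) < s - c"
        using nat_approx_posE[of "s - c"] \<open>c < s\<close> by auto
      then have "real_of_rat (q c n) < s" if "n \<ge> m" for n
      proof -
        have "1 / real (Suc n) \<le> 1 / real (Suc m)"
          using that by (simp add: frac_le)
        then show ?thesis
          using q(2)[of c n] \<open>1 / real (Suc m) < s - c\<close> by linarith
      qed
      then show ?thesis
        by (rule eventually_sequentiallyI)
    qed
    have "(\<lambda>n. abs_L2 (?I (of_rat (q a n)) (of_rat (q b n)))) \<longlonglongrightarrow> abs_L2 (?I a b)"
    proof (rule abs_L2_dominated_convergence[where h = "?I a (b + 1)"])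
      show "sq_integrable (?I a b)" "sq_integrable (?I a (b + 1))"
        "sq_integrable (?I (of_rat (q a n)) (of_rat (q b n)))" for n
        by (intro sq_ind; auto)+
      show "\<bar>?I (of_rat (q a n)) (of_rat (q b n)) s\<bar> \<le> ?I a (b + 1) s" for n s
      proof -
        have "1 / real (Suc n) \<le> 1" by simp
        then have "real_of_rat (q b n) < b + 1"
          using q(2)[of b n] by linarith
        then show ?thesis
          using q(1)[of a n] by (auto simp: indicator_def)
      qed
      show "(\<lambda>n. ?I (of_rat (q a n)) (of_rat (q b n)) s) \<longlonglongrightarrow> ?I a b s" for s
      proof (rule tendsto_eventually)
        have 1: "\<forall>\<^sub>F n in sequentially. real_of_rat (q a n) < s \<longleftrightarrow> a < s"
        proof (cases "a < s")
          case True
          then show ?thesis using ev[OF True] by simp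
        next
          case False
          have "\<not> real_of_rat (q a n) < s" for n
            using q(1)[of a n] False by linarith
          then show ?thesis using False by simp
        qed
        have 2: "\<forall>\<^sub>F n in sequentially. s \<le> real_of_rat (q b n) \<longleftrightarrow> s \<le> b"
        proof (cases "b < s")
          case True
          then show ?thesis using ev[OF True] by (auto elim: eventually_mono)
        next
          case False
          have "s \<le> real_of_rat (q b n)" for n
            using q(1)[of b n] False by linarith
          then show ?thesis using False by simp
        qed
        show "\<forall>\<^sub>F n in sequentially. ?I (of_rat (q a n)) (of_rat (q b n)) s = ?I a b s"
          using 1 2 by eventually_elim (auto simp: indicator_def)
      qed
    qed
    then show ?thesis
      by (rule C_lim[rotated]) (rule C_rat)
  qed
  have C_set: "abs_L2 (indicat_real (A \<inter> {a<..b})) \<in> C" if "A \<in> sets lborel" for A a b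
  proof -
    have "Int_stable (range (\<lambda>(a, b). {a<..b::real}))"
    proof (rule Int_stableI, elim imageE)
      fix u v :: "real set" and p q :: "real \<times> real"
      assume "u = (case p of (a, b) \<Rightarrow> {a<..b})" "v = (case q of (a, b) \<Rightarrow> {a<..b})"
      then have "u \<inter> v = (case (max (fst p) (fst q), min (snd p) (snd q)) of (a, b) \<Rightarrow> {a<..b})"
        by (auto split: prod.splits)
      then show "u \<inter> v \<in> range (\<lambda>(a, b). {a<..b::real})"
        by (rule range_eqI)
    qed
    moreover have "range (\<lambda>(a, b). {a<..b::real}) \<subseteq> Pow UNIV" by simp
    moreover have "A \<in> sigma_sets UNIV (range (\<lambda>(a, b). {a<..b::real}))"
      using that by (simp add: borel_sigma_sets_Ioc)
    ultimately show ?thesis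
    proof (induction rule: sigma_sets_induct_disjoint)
      case (basic A)
      then obtain c d where "A = {c<..d}" by auto
      then have "A \<inter> {a<..b} = {max c a<..min d b}" by auto
      then show ?case by (simp add: C_Ioc)
    next
      case empty
      then show ?case using C_0 by (simp add: zero_L2_def)
    next
      case (compl A)
      then have A: "A \<in> sets lborel" by (simp add: borel_sigma_sets_Ioc)
      have "indicat_real ((UNIV - A) \<inter> {a<..b})
          = (\<lambda>s. ?I a b s - indicat_real (A \<inter> {a<..b}) s)"
        by (auto simp: indicator_def)
      moreover have "abs_L2 (\<lambda>s. ?I a b s - indicat_real (A \<inter> {a<..b}) s)
          = abs_L2 (?I a b) - abs_L2 (indicat_real (A \<inter> {a<..b}))"
        using A by (intro abs_L2_diff[symmetric] sq_ind[of _ a b]) auto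
      ultimately show ?case
        using compl by (auto intro: C_diff C_Ioc)
    next
      case (union A)
      then have A: "A i \<in> sets lborel" for i
        by (auto simp: borel_sigma_sets_Ioc)
      let ?f = "\<lambda>i. indicat_real (A i \<inter> {a<..b})"
      let ?g = "\<lambda>n s. \<Sum>i<n. ?f i s"
      have sq: "sq_integrable (?f i)" for i
        using A by (intro sq_ind[of _ a b]) auto
      have sums: "(\<lambda>i. ?f i s) sums indicat_real ((\<Union>i. A i) \<inter> {a<..b}) s" for s
      proof -
        have "disjoint_family (\<lambda>i. A i \<inter> {a<..b})"
          using union(1) by (auto simp: disjoint_family_on_def)
        then have "(\<lambda>i. ?f i s) sums indicat_real (\<Union>i. A i \<inter> {a<..b}) s"
          by (rule indicator_sums[OF disjoint_family_onD]) auto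
        then show ?thesis by (simp add: Int_UN_distrib2)
      qed
      have "(\<lambda>n. abs_L2 (?g n)) \<longlonglongrightarrow> abs_L2 (indicat_real ((\<Union>i. A i) \<inter> {a<..b}))"
      proof (rule abs_L2_dominated_convergence[where h = "?I a b"])
        show "sq_integrable (indicat_real ((\<Union>i. A i) \<inter> {a<..b}))"
          using A by (intro sq_ind[of _ a b]) auto
        show "sq_integrable (?g n)" for n
          using sq by (intro abs_L2_sum[THEN conjunct1]) auto
        show "sq_integrable (?I a b)"
          by (intro sq_ind) auto
        show "(\<lambda>n. ?g n s) \<longlonglongrightarrow> indicat_real ((\<Union>i. A i) \<inter> {a<..b}) s" for s
          using sums by (simp add: sums_def)
        show "\<bar>?g n s\<bar> \<le> ?I a b s" for n s
        proof -
          have "?g n s \<le> (\<Sum>i. ?f i s)"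
            using sums[of s] by (intro sum_le_suminf) (auto intro: sums_summable)
          also have "\<dots> = indicat_real ((\<Union>i. A i) \<inter> {a<..b}) s"
            by (rule sums_unique[OF sums, symmetric])
          also have "\<dots> \<le> ?I a b s"
            by (auto simp: indicator_def)
          finally show ?thesis by (simp add: sum_nonneg)
        qed
      qed
      moreover have "abs_L2 (?g n) \<in> C" for n
        using abs_L2_sum[of "{..<n}" ?f] sq union(3)
        by (metis C_sum finite_lessThan)
      ultimately show ?case
        by (rule C_lim[rotated])
    qed
  qed
  have "x \<in> C" for x
  proof -
    obtain F where F: "\<And>i. simple_function lborel (F i)"
        "\<And>s. (\<lambda>i. F i s) \<longlonglongrightarrow> rep_L2 x s" "\<And>i s. dist (F i s) 0 \<le> 2 * dist (rep_L2 x s) 0"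
      using borel_measurable_implies_sequence_metric[OF L2_rep_measurable, of x 0]
      by (auto simp: space_borel)
    let ?J = "\<lambda>i. {- real i<..real i}"
    let ?g = "\<lambda>i s. F i s * indicat_real (?J i) s"
    let ?A = "\<lambda>i v. F i -` {v} \<inter> ?J i"
    have fin: "finite (range (F i))" for i
      using simple_functionD(1)[OF F(1)[of i]] by simp
    have meas: "F i -` {v} \<in> sets lborel" for i v
      using simple_functionD(2)[OF F(1)[of i], of "{v}"] by simp
    have sqA: "sq_integrable (indicat_real (?A i v))" for i v
      using meas by (intro sq_ind[of _ "- real i" "real i"]) auto
    have g_eq: "?g i = (\<lambda>s. \<Sum>v\<in>range (F i). v * indicat_real (?A i v) s)" for i
    proof
      fix s
      have "(\<Sum>v\<in>range (F i). v * indicat_real (?A i v) s)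
          = (\<Sum>v\<in>{F i s}. v * indicat_real (?A i v) s)"
        using fin by (intro sum.mono_neutral_right) (auto simp: indicator_def)
      then show "?g i s = (\<Sum>v\<in>range (F i). v * indicat_real (?A i v) s)"
        by (simp add: indicator_def)
    qed
    have g: "sq_integrable (?g i) \<and> abs_L2 (?g i) \<in> C" for i
    proof -
      have *: "sq_integrable (\<lambda>s. \<Sum>v\<in>range (F i). v * indicat_real (?A i v) s) \<and>
          (\<Sum>v\<in>range (F i). abs_L2 (\<lambda>s. v * indicat_real (?A i v) s))
            = abs_L2 (\<lambda>s. \<Sum>v\<in>range (F i). v * indicat_real (?A i v) s)"
        using fin sqA by (intro abs_L2_sum sq_integrable_cmult) auto
      have "abs_L2 (\<lambda>s. v * indicat_real (?A i v) s) \<in> C" for v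
        using C_scaleR[OF C_set[OF meas[of i v], of "- real i" "real i"], of v] sqA
        by (simp add: abs_L2_scaleR)
      then show ?thesis
        using * unfolding g_eq by (metis (no_types, lifting) C_sum)
    qed
    have "(\<lambda>i. abs_L2 (?g i)) \<longlonglongrightarrow> abs_L2 (rep_L2 x)"
    proof (rule abs_L2_dominated_convergence[where h = "\<lambda>s. 2 * \<bar>rep_L2 x s\<bar>"])
      show "sq_integrable (rep_L2 x)" "sq_integrable (?g i)" for i
        using L2_rep g by auto
      have "sq_integrable (\<lambda>s. \<bar>rep_L2 x s\<bar>)"
        using L2_rep[of x] by (simp add: sq_integrable_def)
      then show "sq_integrable (\<lambda>s. 2 * \<bar>rep_L2 x s\<bar>)"
        by (rule sq_integrable_cmult)
      show "\<bar>?g i s\<bar> \<le> 2 * \<bar>rep_L2 x s\<bar>" for i s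
        using F(3)[of i s] by (auto simp: indicator_def)
      show "(\<lambda>i. ?g i s) \<longlonglongrightarrow> rep_L2 x s" for s
      proof -
        obtain m :: nat where m: "\<bar>s\<bar> < real m"
          using reals_Archimedean2 by blast
        have "\<forall>\<^sub>F i in sequentially. F i s = ?g i s"
          using m by (intro eventually_sequentiallyI[of m]) (auto simp: indicator_def)
        then show ?thesis
          using F(2)[of s] by (rule Lim_transform_eventually[rotated])
      qed
    qed
    then show ?thesis
      unfolding L2_abs_rep by (rule C_lim[rotated]) (use g in blast)
  qed
  then have "closure D = UNIV"
    by (auto simp: C_def)
  then show "\<exists>B :: L2 set set. countable B \<and> open = generate_topology B"
    using countable_D by (rule separable_imp_second_countable[rotated])
qed

text \<open>Extension by zero identifies the functions on \<open>(0, L)\<close> with those vanishing outside it.\<close>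

definition L2_interval :: "real \<Rightarrow> L2 set" where
  "L2_interval L = {x. AE s in lborel. s \<notin> {0<..<L} \<longrightarrow> rep_L2 x s = 0}"

definition abs_continuous_on :: "real \<Rightarrow> real \<Rightarrow> (real \<Rightarrow> real) \<Rightarrow> bool" where
  "abs_continuous_on a b f \<longleftrightarrow>
    (\<forall>\<epsilon>>0. \<exists>\<delta>>0. \<forall>D :: (real \<times> real) set.
       finite D \<and> (\<forall>(u, v)\<in>D. a \<le> u \<and> u \<le> v \<and> v \<le> b)
         \<and> disjoint_family_on (\<lambda>(u, v). {u<..<v}) D \<and> (\<Sum>(u, v)\<in>D. v - u) < \<delta>
       \<longrightarrow> (\<Sum>(u, v)\<in>D. \<bar>f v - f u\<bar>) < \<epsilon>)"

text \<open>
  Unbounded operators are given by their graphs: the domain is \<open>Domain T\<close>, composition is \<open>O\<close>, and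
  the inverse of an injective operator is \<open>T\<inverse>\<close>.
\<close>

definition op_app :: "('a \<times> 'b) set \<Rightarrow> 'a \<Rightarrow> 'b" where
  "op_app T x = (THE y. (x, y) \<in> T)"

text \<open>
  The operator \<open>x \<mapsto> - x''\<close> with Dirichlet conditions. Here \<open>u\<close> is the absolutely continuous
  representative of \<open>x\<close>, \<open>u'\<close> is its derivative, again absolutely continuous up to the boundary, and
  \<open>u'\<close> has an almost everywhere defined derivative \<open>- y\<close> which is square integrable.
\<close>

definition dirichlet_laplacian :: "real \<Rightarrow> (L2 \<times> L2) set" where
  "dirichlet_laplacian L =
    {(x, y). x \<in> L2_interval L \<and> y \<in> L2_interval L \<and>
      (\<exists>u u'. abs_continuous_on 0 L u \<and> abs_continuous_on 0 L u' \<and> u 0 = 0 \<and> u L = 0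
        \<and> (AE s in lborel. s \<in> {0<..<L} \<longrightarrow> rep_L2 x s = u s)
        \<and> (\<forall>s\<in>{0<..<L}. (u has_real_derivative u' s) (at s))
        \<and> (AE s in lborel. s \<in> {0<..<L} \<longrightarrow> (u' has_real_derivative - rep_L2 y s) (at s)))}"

text \<open>In the next four definitions \<open>H\<close> is the closed subspace on which the operators act.\<close>

definition adjoint_op :: "'a::real_inner set \<Rightarrow> ('a \<times> 'a) set \<Rightarrow> ('a \<times> 'a) set" where
  "adjoint_op H T = {(y, z). y \<in> H \<and> z \<in> H \<and> (\<forall>(x, x')\<in>T. x' \<bullet> y = x \<bullet> z)}"

definition self_adjoint_op :: "'a::real_inner set \<Rightarrow> ('a \<times> 'a) set \<Rightarrow> bool" where
  "self_adjoint_op H T \<longleftrightarrow> T \<subseteq> H \<times> H \<and> H \<subseteq> closure (Domain T) \<and> adjoint_op H T = T"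

definition positive_op :: "('a::real_inner \<times> 'a) set \<Rightarrow> bool" where
  "positive_op T \<longleftrightarrow> (\<forall>(x, y)\<in>T. x \<noteq> 0 \<longrightarrow> 0 < x \<bullet> y)"

definition is_positive_sqrt :: "'a::real_inner set \<Rightarrow> ('a \<times> 'a) set \<Rightarrow> ('a \<times> 'a) set \<Rightarrow> bool" where
  "is_positive_sqrt H A S \<longleftrightarrow> self_adjoint_op H S \<and> positive_op S \<and> S O S = A"

text \<open>
  From here on \<open>S\<close> is the graph of the positive square root of the Dirichlet Laplacian. It
  determines the space \<open>X_half S\<close> with its inner product and norm.
\<close>

definition X_half :: "(L2 \<times> L2) set \<Rightarrow> L2 set" where
  "X_half S = Domain S"

definition inner_half :: "(L2 \<times> L2) set \<Rightarrow> L2 \<Rightarrow> L2 \<Rightarrow> real" where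
  "inner_half S x y = op_app S x \<bullet> op_app S y"

definition norm_half :: "(L2 \<times> L2) set \<Rightarrow> L2 \<Rightarrow> real" where
  "norm_half S x = sqrt (inner_half S x x)"

definition J_op :: "(L2 \<times> L2) set \<Rightarrow> L2 \<Rightarrow> L2" where
  "J_op S = op_app (S\<inverse>)"

definition J_mu :: "(L2 \<times> L2) set \<Rightarrow> real \<Rightarrow> L2 \<Rightarrow> L2 \<times> L2" where
  "J_mu S \<mu> w = (J_op S w, \<mu> *\<^sub>R w)"

definition norm_half_pair :: "(L2 \<times> L2) set \<Rightarrow> L2 \<times> L2 \<Rightarrow> real" where
  "norm_half_pair S p = sqrt ((norm_half S (fst p))\<^sup>2 + (norm_half S (snd p))\<^sup>2)"

text \<open>
  Square integrable functions from \<open>[0, t]\<close> to \<open>X_half S\<close>. As \<open>S\<close> maps \<open>X_half S\<close> isometrically onto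
  \<open>L2_interval L\<close>, measurability with respect to the norm of \<open>X_half S\<close> is measurability of
  \<open>S \<circ> w\<close>. Functions are not identified when they agree almost everywhere; the payoff below
  does not distinguish them.
\<close>

definition W_space :: "(L2 \<times> L2) set \<Rightarrow> real \<Rightarrow> (real \<Rightarrow> L2) set" where
  "W_space S t = {w. (\<forall>s\<in>{0..t}. w s \<in> X_half S)
     \<and> (\<lambda>s. op_app S (w s)) \<in> borel_measurable (lebesgue_on {0..t})
     \<and> integrable (lebesgue_on {0..t}) (\<lambda>s. (norm_half S (w s))\<^sup>2)}"

text \<open>
  A Bochner integral. As \<open>X_half S\<close> embeds continuously into the ambient space, the integral taken
  in \<open>X_half S\<close> of a function in \<open>W_space S t\<close> is the one taken in the ambient space.
\<close>

definition trajectory :: "L2 \<Rightarrow> (real \<Rightarrow> L2) \<Rightarrow> real \<Rightarrow> L2" where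
  "trajectory x w s = x + (LINT \<sigma>|lebesgue_on {0..s}. w \<sigma>)"

definition payoff ::
  "real \<Rightarrow> (L2 \<times> L2) set \<Rightarrow> real \<Rightarrow> real \<Rightarrow> (L2 \<Rightarrow> ereal) \<Rightarrow> real \<Rightarrow> L2 \<Rightarrow> (real \<Rightarrow> L2) \<Rightarrow> ereal" where
  "payoff \<kappa> S \<mu> M \<psi> t x w =
     ereal (LINT s|lebesgue_on {0..t}.
        \<kappa> / 2 * (norm_half S (trajectory x w s))\<^sup>2 - M / 2 * (norm_half_pair S (J_mu S \<mu> (w s)))\<^sup>2)
     + \<psi> (trajectory x w t)"

definition value_fn ::
  "real \<Rightarrow> (L2 \<times> L2) set \<Rightarrow> real \<Rightarrow> real \<Rightarrow> (L2 \<Rightarrow> ereal) \<Rightarrow> real \<Rightarrow> L2 \<Rightarrow> ereal" where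
  "value_fn \<kappa> S \<mu> M \<psi> t x = (SUP w\<in>W_space S t. payoff \<kappa> S \<mu> M \<psi> t x w)"

definition bounded_linear_half :: "(L2 \<times> L2) set \<Rightarrow> (L2 \<Rightarrow> L2) \<Rightarrow> bool" where
  "bounded_linear_half S K \<longleftrightarrow>
     (\<forall>x\<in>X_half S. K x \<in> X_half S)
     \<and> (\<forall>x\<in>X_half S. \<forall>y\<in>X_half S. K (x + y) = K x + K y)
     \<and> (\<forall>c. \<forall>x\<in>X_half S. K (c *\<^sub>R x) = c *\<^sub>R K x)
     \<and> (\<exists>C. \<forall>x\<in>X_half S. norm_half S (K x) \<le> C * norm_half S x)"

definition boundedly_invertible_half :: "(L2 \<times> L2) set \<Rightarrow> (L2 \<Rightarrow> L2) \<Rightarrow> bool" where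
  "boundedly_invertible_half S K \<longleftrightarrow>
     (\<exists>K'. bounded_linear_half S K' \<and> (\<forall>x\<in>X_half S. K' (K x) = x \<and> K (K' x) = x))"

definition psi_inf :: "(L2 \<times> L2) set \<Rightarrow> (L2 \<Rightarrow> L2) \<Rightarrow> L2 \<Rightarrow> L2 \<Rightarrow> ereal" where
  "psi_inf S K x z = (if norm_half S (K (x - z)) = 0 then 0 else -\<infinity>)"

definition value_inf ::
  "real \<Rightarrow> (L2 \<times> L2) set \<Rightarrow> (L2 \<Rightarrow> L2) \<Rightarrow> real \<Rightarrow> real \<Rightarrow> real \<Rightarrow> L2 \<Rightarrow> L2 \<Rightarrow> ereal" where
  "value_inf \<kappa> S K \<mu> M t x z = value_fn \<kappa> S \<mu> M (\<lambda>y. psi_inf S K y z) t x"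

definition t_bar :: "real \<Rightarrow> real \<Rightarrow> real \<Rightarrow> real" where
  "t_bar m \<kappa> \<mu> = \<mu> * sqrt (2 * m / \<kappa>)"

end

theory Submission
  imports Defs
begin

text \<open>
  The identity is an interchange of suprema: a control \<open>w\<close> contributes to the right-hand side only
  at the single point \<open>z = \<xi>(t)\<close>. What has to be checked is that this endpoint lies in the domain of
  the square root, which is a graph-closedness argument (integrate the defining identity of the
  adjoint), and that the singular payoff vanishes exactly on the diagonal.
\<close>

text \<open>Completeness is already available; \<open>banach\<close> is the class for which the
  Bochner integration lemmas used below are stated.\<close>

instance L2 :: banach ..

section \<open>Suprema over fibres\<close>

text \<open>The index set \<open>W\<close> is sorted by the value of \<open>T\<close>. On each fibre
  the term in \<open>\<psi>\<close> is constant, and the penalty \<open>-\<infinity>\<close>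
  discards everything off the fibre.\<close>

lemma SUP_fibre_decomposition:
  fixes I :: "'w \<Rightarrow> real" and \<psi> :: "'z \<Rightarrow> real"
  assumes T: "\<And>w. w \<in> W \<Longrightarrow> T w \<in> Z"
  shows "(SUP w\<in>W. ereal (I w) + ereal (\<psi> (T w)))
       = (SUP z\<in>Z. (SUP w\<in>W. ereal (I w) + (if T w = z then 0 else -\<infinity>)) + ereal (\<psi> z))"
    (is "?l = ?r")
proof (rule antisym)
  show "?l \<le> ?r"
  proof (rule SUP_least)
    fix w assume w: "w \<in> W"
    have "ereal (I w) \<le> (SUP v\<in>W. ereal (I v) + (if T v = T w then 0 else -\<infinity>))"
      by (rule SUP_upper2[OF w]) simp
    then have "ereal (I w) + ereal (\<psi> (T w))
        \<le> (SUP v\<in>W. ereal (I v) + (if T v = T w then 0 else -\<infinity>)) + ereal (\<psi> (T w))"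
      by (rule add_right_mono)
    also have "\<dots> \<le> ?r"
      by (rule SUP_upper[OF T[OF w]])
    finally show "ereal (I w) + ereal (\<psi> (T w)) \<le> ?r" .
  qed
  show "?r \<le> ?l"
  proof (rule SUP_least)
    fix z assume "z \<in> Z"
    \<comment> \<open>Since \<open>\<psi> z\<close> is finite it can be moved to the other side, so
      no constant has to be pulled out of a supremum, and an empty fibre needs no separate
      case.\<close>
    have "(SUP w\<in>W. ereal (I w) + (if T w = z then 0 else -\<infinity>)) \<le> ?l - ereal (\<psi> z)"
    proof (rule SUP_least)
      fix w assume w: "w \<in> W"
      show "ereal (I w) + (if T w = z then 0 else -\<infinity>) \<le> ?l - ereal (\<psi> z)"
      proof (cases "T w = z")
        case True
        then have "ereal (I w) + ereal (\<psi> z) \<le> ?l"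
          using SUP_upper[OF w, of "\<lambda>w. ereal (I w) + ereal (\<psi> (T w))"] by simp
        then show ?thesis
          using True by (simp add: ereal_le_minus)
      qed simp
    qed
    then show "(SUP w\<in>W. ereal (I w) + (if T w = z then 0 else -\<infinity>)) + ereal (\<psi> z) \<le> ?l"
      by (simp add: ereal_le_minus)
  qed
qed

section \<open>The space over the interval as an annihilator\<close>

text \<open>Unlike the almost everywhere condition on representatives, orthogonality is visibly
  linear and commutes with Bochner integrals.\<close>

lemma L2_interval_iff_orthogonal:
  "x \<in> L2_interval L \<longleftrightarrow>
    (\<forall>g. (AE s in lborel. s \<in> {0<..<L} \<longrightarrow> rep_L2 g s = 0) \<longrightarrow> x \<bullet> g = 0)"
proof
  assume x: "x \<in> L2_interval L"
  show "\<forall>g. (AE s in lborel. s \<in> {0<..<L} \<longrightarrow> rep_L2 g s = 0) \<longrightarrow> x \<bullet> g = 0"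
  proof (intro allI impI)
    fix g assume g: "AE s in lborel. s \<in> {0<..<L} \<longrightarrow> rep_L2 g s = 0"
    have "AE s in lborel. rep_L2 x s * rep_L2 g s = 0"
      using x[unfolded L2_interval_def mem_Collect_eq] g by eventually_elim auto
    then show "x \<bullet> g = 0"
      unfolding inner_L2_def by (rule integral_eq_zero_AE)
  qed
next
  assume orth: "\<forall>g. (AE s in lborel. s \<in> {0<..<L} \<longrightarrow> rep_L2 g s = 0) \<longrightarrow> x \<bullet> g = 0"
  \<comment> \<open>The part of \<open>x\<close> outside the interval serves as test vector: its
    inner product with \<open>x\<close> is its own squared norm.\<close>
  define f where "f s = rep_L2 x s * indicat_real (- {0<..<L}) s" for s
  have f_sq: "(f s)\<^sup>2 = (rep_L2 x s)\<^sup>2 * indicat_real (- {0<..<L}) s" for s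
    by (simp add: f_def indicator_def)
  have f: "sq_integrable f"
    unfolding sq_integrable_def f_sq
    using L2_rep[of x] integrable_mult_indicator[of "- {0<..<L}" lborel "\<lambda>s. (rep_L2 x s)\<^sup>2"]
    by (auto simp: sq_integrable_def f_def[abs_def] mult.commute)
  have "AE s in lborel. s \<in> {0<..<L} \<longrightarrow> rep_L2 (abs_L2 f) s = 0"
    using L2_rep_abs[OF f] by eventually_elim (auto simp: f_def indicator_def)
  then have "0 = x \<bullet> abs_L2 f"
    using orth by simp
  also have "\<dots> = (LINT s|lborel. (f s)\<^sup>2)"
    unfolding inner_L2_def
  proof (rule integral_cong_AE)
    show "AE s in lborel. rep_L2 x s * rep_L2 (abs_L2 f) s = (f s)\<^sup>2"
      using L2_rep_abs[OF f]
      by eventually_elim (auto simp: f_def power2_eq_square indicator_def)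
  qed (use f in \<open>auto simp: sq_integrable_def\<close>)
  finally have "AE s in lborel. (f s)\<^sup>2 = 0"
    using f integral_nonneg_eq_0_iff_AE[of lborel "\<lambda>s. (f s)\<^sup>2"]
    by (simp add: sq_integrable_def)
  then show "x \<in> L2_interval L"
    unfolding L2_interval_def mem_Collect_eq by eventually_elim (auto simp: f_def indicator_def)
qed

lemma subspace_L2_interval: "subspace (L2_interval L)"
  unfolding subspace_def by (auto simp: L2_interval_iff_orthogonal inner_add_left)

lemma integral_in_L2_interval:
  assumes w: "integrable M w" and mem: "\<And>s. s \<in> space M \<Longrightarrow> w s \<in> L2_interval L"
  shows "integral\<^sup>L M w \<in> L2_interval L"
  unfolding L2_interval_iff_orthogonal
proof (intro allI impI)
  fix g assume g: "AE s in lborel. s \<in> {0<..<L} \<longrightarrow> rep_L2 g s = 0"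
  have "(LINT s|M. w s) \<bullet> g = (LINT s|M. w s \<bullet> g)"
    using w by simp
  also have "\<dots> = (LINT s|M. 0)"
    using mem g by (intro Bochner_Integration.integral_cong) (auto simp: L2_interval_iff_orthogonal)
  finally show "integral\<^sup>L M w \<bullet> g = 0"
    by simp
qed

section \<open>Graphs of self-adjoint operators\<close>

text \<open>Self-adjointness turned into a membership test: a pair belongs to the graph as soon as
  it satisfies the adjoint identity.\<close>

lemma self_adjoint_op_iff:
  assumes "self_adjoint_op H S"
  shows "(y, z) \<in> S \<longleftrightarrow> y \<in> H \<and> z \<in> H \<and> (\<forall>(x, x')\<in>S. x' \<bullet> y = x \<bullet> z)"
proof -
  have "(y, z) \<in> S \<longleftrightarrow> (y, z) \<in> adjoint_op H S"
    using assms by (simp add: self_adjoint_op_def)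
  then show ?thesis
    by (simp add: adjoint_op_def)
qed

lemma subspace_self_adjoint_op:
  assumes S: "self_adjoint_op H S" and H: "subspace H"
  shows "subspace S"
  unfolding subspace_def
proof (intro conjI ballI allI)
  show "0 \<in> S"
    unfolding zero_prod_def self_adjoint_op_iff[OF S] using subspace_0[OF H] by auto
next
  fix p q assume pq: "p \<in> S" "q \<in> S"
  obtain y z y' z' where p: "p = (y, z)" "q = (y', z')"
    by (metis surj_pair)
  have "(y + y', z + z') \<in> S"
    using pq unfolding p self_adjoint_op_iff[OF S]
    by (auto simp: inner_add_right subspace_add[OF H] split_beta)
  then show "p + q \<in> S"
    by (simp add: p)
next
  fix c p assume p_S: "p \<in> S"
  obtain y z where p: "p = (y, z)"
    by (metis surj_pair)
  have "(c *\<^sub>R y, c *\<^sub>R z) \<in> S"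
    using p_S unfolding p self_adjoint_op_iff[OF S]
    by (auto simp: subspace_scale[OF H] split_beta)
  then show "c *\<^sub>R p \<in> S"
    by (simp add: p)
qed

text \<open>The difference \<open>y - z\<close> is orthogonal to the domain of \<open>S\<close>,
  hence to its closure, which contains \<open>y - z\<close> itself.\<close>

lemma self_adjoint_op_single_valued:
  assumes S: "self_adjoint_op H S" and H: "subspace H" and yz: "(x, y) \<in> S" "(x, z) \<in> S"
  shows "y = z"
proof -
  have "(0, y - z) \<in> S"
    using subspace_diff[OF subspace_self_adjoint_op[OF S H] yz] by simp
  then have yzH: "y - z \<in> H" and orth: "\<And>u. u \<in> Domain S \<Longrightarrow> u \<bullet> (y - z) = 0"
    unfolding self_adjoint_op_iff[OF S] by fastforce+
  have "closed {u. u \<bullet> (y - z) = 0}"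
    by (intro closed_Collect_eq continuous_intros)
  then have "closure (Domain S) \<subseteq> {u. u \<bullet> (y - z) = 0}"
    by (intro closure_minimal) (use orth in auto)
  moreover have "y - z \<in> closure (Domain S)"
    using S yzH by (auto simp: self_adjoint_op_def)
  ultimately have "(y - z) \<bullet> (y - z) = 0"
    by blast
  then show ?thesis
    by simp
qed

lemma self_adjoint_op_app:
  assumes "self_adjoint_op H S" "subspace H" "(x, y) \<in> S"
  shows "op_app S x = y"
  unfolding op_app_def using assms self_adjoint_op_single_valued by blast

lemma self_adjoint_op_app_mem:
  assumes "self_adjoint_op H S" "subspace H" "x \<in> Domain S"
  shows "(x, op_app S x) \<in> S"
  using assms self_adjoint_op_app by fastforce

lemma subspace_X_half:
  assumes "self_adjoint_op H S" "subspace H"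
  shows "subspace (X_half S)"
proof -
  have "X_half S = fst ` S"
    by (auto simp: X_half_def Domain_fst)
  then show ?thesis
    using linear_subspace_image[OF linear_fst subspace_self_adjoint_op[OF assms]] by simp
qed

text \<open>Strict positivity excludes a nonzero \<open>x\<close> with image \<open>0\<close>, so
  the seminorm is definite.\<close>

lemma norm_half_eq_0_iff:
  assumes S: "self_adjoint_op H S" "subspace H" and pos: "positive_op S" and x: "x \<in> X_half S"
  shows "norm_half S x = 0 \<longleftrightarrow> x = 0"
proof
  assume "norm_half S x = 0"
  then have "(x, 0) \<in> S"
    using self_adjoint_op_app_mem[OF S, of x] x
    by (simp add: norm_half_def inner_half_def X_half_def)
  then show "x = 0"
    using pos by (fastforce simp: positive_op_def)
next
  assume "x = 0"
  moreover have "(0, 0) \<in> S"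
    using subspace_0[OF subspace_self_adjoint_op[OF S]] by (simp add: zero_prod_def)
  ultimately show "norm_half S x = 0"
    using self_adjoint_op_app[OF S] by (simp add: norm_half_def inner_half_def)
qed

section \<open>Endpoints of trajectories\<close>

text \<open>An instance of Hille's theorem on closed operators: the pair of integrals of
  \<open>w\<close> and of its image under \<open>S\<close> passes the membership test for the
  graph.\<close>

lemma integral_in_X_half:
  assumes S: "self_adjoint_op (L2_interval L) S"
    and w: "integrable M w" and Sw: "integrable M (\<lambda>s. op_app S (w s))"
    and mem: "\<And>s. s \<in> space M \<Longrightarrow> w s \<in> X_half S"
  shows "integral\<^sup>L M w \<in> X_half S"
proof -
  have graph: "(w s, op_app S (w s)) \<in> S" if "s \<in> space M" for s
    using self_adjoint_op_app_mem[OF S subspace_L2_interval] mem[OF that] by (simp add: X_half_def)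
  then have wS: "w s \<in> L2_interval L" "op_app S (w s) \<in> L2_interval L" if "s \<in> space M" for s
    using S that by (auto simp: self_adjoint_op_def)
  have "x' \<bullet> integral\<^sup>L M w = x \<bullet> (LINT s|M. op_app S (w s))" if "(x, x') \<in> S" for x x'
  proof -
    have "x' \<bullet> integral\<^sup>L M w = (LINT s|M. x' \<bullet> w s)"
      using w by simp
    also have "\<dots> = (LINT s|M. x \<bullet> op_app S (w s))"
    proof (intro Bochner_Integration.integral_cong refl)
      fix s assume "s \<in> space M"
      then have "\<forall>(u, u')\<in>S. u' \<bullet> w s = u \<bullet> op_app S (w s)"
        using graph[of s] self_adjoint_op_iff[OF S, of "w s"] by blast
      then show "x' \<bullet> w s = x \<bullet> op_app S (w s)"
        using that by blast
    qed
    also have "\<dots> = x \<bullet> (LINT s|M. op_app S (w s))"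
      using Sw by simp
    finally show ?thesis .
  qed
  then have "(integral\<^sup>L M w, LINT s|M. op_app S (w s)) \<in> S"
    unfolding self_adjoint_op_iff[OF S, of "integral\<^sup>L M w"]
    using integral_in_L2_interval[OF w] integral_in_L2_interval[OF Sw] wS by auto
  then show ?thesis
    by (auto simp: X_half_def)
qed

lemma trajectory_in_X_half:
  assumes S: "self_adjoint_op (L2_interval L) S" and x: "x \<in> X_half S" and w: "w \<in> W_space S t"
  shows "trajectory x w t \<in> X_half S"
proof -
  let ?M = "lebesgue_on {0..t}"
  have X: "subspace (X_half S)"
    by (rule subspace_X_half[OF S subspace_L2_interval])
  interpret finite_measure ?M
    by (rule finite_measure_lebesgue_on) simp
  have "(LINT s|?M. w s) \<in> X_half S"
  proof (cases "integrable ?M w")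
    case True
    have "integrable ?M (\<lambda>s. op_app S (w s))"
    proof (rule Bochner_Integration.integrable_bound)
      \<comment> \<open>Square integrability yields integrability because the time interval has
        finite measure, which makes the constant \<open>1\<close> integrable.\<close>
      show "integrable ?M (\<lambda>s. 1 + (norm_half S (w s))\<^sup>2)"
        using w by (auto simp: W_space_def)
      show "(\<lambda>s. op_app S (w s)) \<in> borel_measurable ?M"
        using w by (simp add: W_space_def)
      have "norm (op_app S (w s)) \<le> 1 + (norm_half S (w s))\<^sup>2" for s
      proof -
        have "norm_half S (w s) = norm (op_app S (w s))"
          by (simp add: norm_half_def inner_half_def norm_eq_sqrt_inner)
        \<comment> \<open>For a norm \<open>a\<close> this gives
          \<open>2 * a \<le> 1 + a\<^sup>2\<close>, and \<open>a \<le> 2 * a\<close> because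
          \<open>a\<close> is nonnegative.\<close>
        moreover have "0 \<le> (norm (op_app S (w s)) - 1)\<^sup>2"
          by simp
        ultimately show ?thesis
          by (simp add: power2_diff) (smt (verit) norm_ge_zero)
      qed
      then show "AE s in ?M. norm (op_app S (w s)) \<le> norm (1 + (norm_half S (w s))\<^sup>2)"
        by (intro AE_I2) (simp add: abs_of_nonneg)
    qed
    then show ?thesis
      using w by (intro integral_in_X_half[OF S True]) (auto simp: W_space_def)
  next
    case False \<comment> \<open>excluded in fact, but harmless: a non-integrable function has integral \<open>0\<close>\<close>
    then show ?thesis
      using subspace_0[OF X] by (simp add: not_integrable_integral_eq)
  qed
  then show ?thesis
    unfolding trajectory_def by (intro subspace_add[OF X x])
qed

section \<open>The singular payoff and the value functions\<close>

text \<open>The inverse makes \<open>K\<close> injective on \<open>X_half S\<close>, and the norm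
  there is definite, so the penalty vanishes only on the diagonal.\<close>

lemma psi_inf_eq:
  assumes S: "self_adjoint_op H S" "subspace H" and pos: "positive_op S"
    and K: "bounded_linear_half S K" "boundedly_invertible_half S K"
    and y: "y \<in> X_half S" and z: "z \<in> X_half S"
  shows "psi_inf S K y z = (if y = z then 0 else -\<infinity>)"
proof -
  have X: "subspace (X_half S)"
    by (rule subspace_X_half[OF S])
  have zero: "F 0 = 0" if "bounded_linear_half S F" for F
  proof -
    \<comment> \<open>Homogeneity is available only on \<open>X_half S\<close>, which contains
      \<open>0\<close> as a subspace.\<close>
    have "F (0 *\<^sub>R 0) = 0 *\<^sub>R F 0"
      using that subspace_0[OF X] unfolding bounded_linear_half_def by blast
    then show ?thesis
      by simp
  qed
  obtain K' where K': "bounded_linear_half S K'" "\<And>v. v \<in> X_half S \<Longrightarrow> K' (K v) = v"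
    using K(2) by (auto simp: boundedly_invertible_half_def)
  have d: "y - z \<in> X_half S"
    by (rule subspace_diff[OF X y z])
  then have "norm_half S (K (y - z)) = 0 \<longleftrightarrow> K (y - z) = 0"
    using K(1) by (intro norm_half_eq_0_iff[OF S pos]) (simp add: bounded_linear_half_def)
  also have "\<dots> \<longleftrightarrow> y - z = 0"
    using zero[OF K(1)] zero[OF K'(1)] K'(2)[OF d] by metis
  finally show ?thesis
    by (simp add: psi_inf_def)
qed

theorem theorem3p1:
  fixes L \<kappa> m m_low \<mu> t :: real
    and sqrtA :: "(L2 \<times> L2) set"
    and K :: "L2 \<Rightarrow> L2"
    and \<psi> :: "L2 \<Rightarrow> real"
    and x :: L2
  assumes "L > 0" "\<kappa> > 0" "m > 0"
    and "is_positive_sqrt (L2_interval L) (dirichlet_laplacian L) sqrtA"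
    and "0 < m_low" "m_low < m"
    and "\<And>\<nu> s y. 0 < \<nu> \<Longrightarrow> \<nu> \<le> 1 \<Longrightarrow> 0 < s \<Longrightarrow> s < t_bar m \<kappa> \<nu> \<Longrightarrow> y \<in> X_half sqrtA
           \<Longrightarrow> value_fn \<kappa> sqrtA \<nu> m_low (\<lambda>_. 0) s y < \<infinity>"
    and "\<mu> > 0"
    and "bounded_linear_half sqrtA K" "boundedly_invertible_half sqrtA K"
    and "concave_on (X_half sqrtA) \<psi>"
    and "0 \<le> t" "t < t_bar m \<kappa> \<mu>"
    and "x \<in> X_half sqrtA"
  shows "value_fn \<kappa> sqrtA \<mu> m (\<lambda>y. ereal (\<psi> y)) t x
       = (SUP z\<in>X_half sqrtA. value_inf \<kappa> sqrtA K \<mu> m t x z + ereal (\<psi> z))"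
proof -
  have S: "self_adjoint_op (L2_interval L) sqrtA" and pos: "positive_op sqrtA"
    using assms(4) by (auto simp: is_positive_sqrt_def)
  \<comment> \<open>The running payoff, common to both value functions. It is always a real number,
    since a non-integrable integrand has integral \<open>0\<close> by convention, so
    \<open>SUP_fibre_decomposition\<close> applies.\<close>
  define I where "I w = (LINT s|lebesgue_on {0..t}.
      \<kappa> / 2 * (norm_half sqrtA (trajectory x w s))\<^sup>2
      - m / 2 * (norm_half_pair sqrtA (J_mu sqrtA \<mu> (w s)))\<^sup>2)" for w
  have traj: "trajectory x w t \<in> X_half sqrtA" if "w \<in> W_space sqrtA t" for w
    using trajectory_in_X_half[OF S \<open>x \<in> X_half sqrtA\<close> that] .
  \<comment> \<open>The endpoint bound \<open>traj\<close> is what allows \<open>psi_inf_eq\<close>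
    to be applied to every control.\<close>
  have inf: "value_inf \<kappa> sqrtA K \<mu> m t x z
      = (SUP w\<in>W_space sqrtA t. ereal (I w) + (if trajectory x w t = z then 0 else -\<infinity>))"
    if z: "z \<in> X_half sqrtA" for z
    unfolding value_inf_def value_fn_def payoff_def I_def
    by (intro SUP_cong refl arg_cong2[where f = "(+)"]
        psi_inf_eq[OF S subspace_L2_interval pos assms(9,10) traj z])
  have "value_fn \<kappa> sqrtA \<mu> m (\<lambda>y. ereal (\<psi> y)) t x
      = (SUP w\<in>W_space sqrtA t. ereal (I w) + ereal (\<psi> (trajectory x w t)))"
    by (simp add: value_fn_def payoff_def I_def)
  also have "\<dots> = (SUP z\<in>X_half sqrtA. (SUP w\<in>W_space sqrtA t.
      ereal (I w) + (if trajectory x w t = z then 0 else -\<infinity>)) + ereal (\<psi> z))"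
    by (rule SUP_fibre_decomposition[OF traj])
  also have "\<dots> = (SUP z\<in>X_half sqrtA. value_inf \<kappa> sqrtA K \<mu> m t x z + ereal (\<psi> z))"
    by (intro SUP_cong) (simp_all add: inf)
  finally show ?thesis .
qed

end
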